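(* Let $(S,G)$ be a combinatorial surface and let $f$ be a vertex scalar field on $(S,G)$. Then $\operatorname{whirl}(\operatorname{tilt} f) = 0$; that is, $\operatorname{whirl}(\operatorname{tilt} f)(\sigma)=0$ for every (oriented) face $\sigma$ of $G$.
   Context: A combinatorial surface $(S,G)$ consists of a compact smooth surface $S \subset \mathbb{R}^n$ (possibly with boundary) and a graph $G$ embedded in $S$. The graph consists of finitely many vertices $\mathcal{V}$ (points of $S$); finitely many edges $\mathcal{E}$, each an embedded C$^1$ curve with endpoints on vertices (loops are allowed; edges meet only at vertices); and faces $\mathcal{F}$, each the closure of a component of $S - (\bigcup \mathcal{V} \cup \bigcup \mathcal{E})$. It is required that: each face is homeomorphic to a disc; each vertex is the endpoint of at least one edge; $\partial S \subset \bigcup \mathcal{E}$; each edge not contained in $\partial S$ lies in the boundary of two distinct faces. An orientation of an edge is a choice of direction along it; the edge points out of its source vertex and into its sink vertex. An orientation of a face $\sigma$ is a choice of orientation on each edge of $\partial\sigma$ such that the sink of each edge is the source of another edge in $\partial\sigma$ (if $\partial\sigma$ is a single loop edge, either orientation of it is allowed); these edge orientations are said to be induced by the orientation of $\sigma$. A vertex scalar field (VSF) is a function $f\colon\mathcal{V}\to\mathbb{R}$. A combinatorial vector field (CVF) $\mathbf{F}$ is a choice of orientation on each edge together with a function $\mathbf{F}\colon\mathcal{E}\to\mathbb{R}$. For an oriented edge $e$, let $\epsilon(e,\mathbf{F})=+1$ if the orientation of $e$ agrees with the one given by $\mathbf{F}$ and $-1$ otherwise. For a VSF $f$, $\operatorname{tilt}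 f$ is the CVF defined as follows: if $e$ has endpoints $v,w$ with $f(v)\le f(w)$, then $\operatorname{tilt} f$ orients $e$ from $v$ to $w$ and $\operatorname{tilt} f(e)=f(w)-f(v)$ (if $f(v)=f(w)$ either orientation may be chosen, and $\operatorname{tilt} f(e)=0$). For a CVF $\mathbf{F}$ and an oriented face $\sigma$, $\operatorname{whirl}\mathbf{F}(\sigma)=\sum_{e\subset\partial\sigma}\epsilon(e,\mathbf{F})\mathbf{F}(e)$, the sum being over the edges $e$ in $\partial\sigma$, each with the orientation induced by $\sigma$. (Reversing the orientation of $\sigma$ changes the sign.) *)

theory Defs
  imports "HOL-Analysis.Analysis"
begin

section \<open>Smooth surfaces with boundary in Euclidean space\<close>

text \<open>For open \<open>W\<close> the following says that \<open>g\<close> is of class C-k on \<open>W\<close>: all iterated directional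
  derivatives up to order \<open>k\<close> exist and are continuous.\<close>

primrec Ck_on :: "nat \<Rightarrow> ('a::euclidean_space \<Rightarrow> 'b::euclidean_space) \<Rightarrow> 'a set \<Rightarrow> bool" where
  "Ck_on 0 g W \<longleftrightarrow> continuous_on W g"
| "Ck_on (Suc k) g W \<longleftrightarrow>
     (\<forall>x\<in>W. g differentiable (at x)) \<and>
     (\<forall>v. Ck_on k (\<lambda>x. frechet_derivative g (at x) v) W)"

text \<open>Smoothness on an arbitrary (not necessarily open) subset of a Euclidean space means, as
  usual, local extendability to a smooth map on an open set.\<close>

definition smooth_map :: "'a::euclidean_space set \<Rightarrow> ('a \<Rightarrow> 'b::euclidean_space) \<Rightarrow> bool" where
  "smooth_map X f \<longleftrightarrow>
     (\<forall>x\<in>X. \<exists>W g. open W \<and> x \<in> W \<and> (\<forall>k. Ck_on k g W) \<and> (\<forall>y\<in>X \<inter> W. g y = f y))"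

definition half_plane :: "(real^2) set" where
  "half_plane = {x. 0 \<le> x $ 2}"

definition local_parametrization ::
    "'a::euclidean_space set \<Rightarrow> (real^2) set \<Rightarrow> (real^2 \<Rightarrow> 'a) \<Rightarrow> bool" where
  "local_parametrization S V \<phi> \<longleftrightarrow>
     openin (top_of_set half_plane) V \<and> openin (top_of_set S) (\<phi> ` V) \<and>
     inj_on \<phi> V \<and> smooth_map V \<phi> \<and> smooth_map (\<phi> ` V) (inv_into V \<phi>)"

definition smooth_surface :: "'a::euclidean_space set \<Rightarrow> bool" where
  "smooth_surface S \<longleftrightarrow> (\<forall>p\<in>S. \<exists>V \<phi>. local_parametrization S V \<phi> \<and> p \<in> \<phi> ` V)"

definition surface_boundary :: "'a::euclidean_space set \<Rightarrow> 'a set" where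
  "surface_boundary S = {\<phi> x |V \<phi> x. local_parametrization S V \<phi> \<and> x \<in> V \<and> x $ 2 = 0}"


section \<open>Combinatorial surfaces\<close>

text \<open>An edge is given by a C-1 parametrization \<open>\<gamma>\<close> over the unit interval; only its values on
  the unit interval matter.  The predicate \<open>simple_path\<close> allows \<open>\<gamma> 0 = \<gamma> 1\<close> (a loop) but no
  other self-intersection.\<close>

definition embedded_C1_curve :: "(real \<Rightarrow> 'a::euclidean_space) \<Rightarrow> bool" where
  "embedded_C1_curve \<gamma> \<longleftrightarrow> simple_path \<gamma> \<and>
     (\<exists>D. continuous_on {0..1} D \<and>
          (\<forall>t\<in>{0..1}. (\<gamma> has_vector_derivative D t) (at t within {0..1}) \<and> D t \<noteq> 0))"

definition faces :: "'a::euclidean_space set \<Rightarrow> 'a set \<Rightarrow> (real \<Rightarrow> 'a) set \<Rightarrow> 'a set set" where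
  "faces S \<V> \<E> = closure ` components (S - (\<V> \<union> (\<Union>e\<in>\<E>. path_image e)))"

text \<open>The boundary circle of a topological closed disc \<open>\<sigma>\<close>.  This is not the frontier of \<open>\<sigma>\<close>
  relative to the surface: if the surface is itself a disc with a single face, then that relative
  frontier is empty.  By invariance of domain the set does not depend on the homeomorphism.\<close>

definition disc_boundary :: "'a::euclidean_space set \<Rightarrow> 'a set" where
  "disc_boundary \<sigma> =
     {h x |h k x. homeomorphism (cball (0::real^2) 1) \<sigma> h k \<and> x \<in> sphere 0 1}"

locale combinatorial_surface =
  fixes S :: "'a::euclidean_space set"
    and \<V> :: "'a set"
    and \<E> :: "(real \<Rightarrow> 'a) set"
  assumes compact_surface: "compact S"
    and smooth: "smooth_surface S"
    and finite_vertices: "finite \<V>"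
    and vertices_subset: "\<V> \<subseteq> S"
    and finite_edges: "finite \<E>"
    and edge_curve: "e \<in> \<E> \<Longrightarrow> embedded_C1_curve e"
    and edge_subset: "e \<in> \<E> \<Longrightarrow> path_image e \<subseteq> S"
    and edge_endpoints: "e \<in> \<E> \<Longrightarrow> pathstart e \<in> \<V> \<and> pathfinish e \<in> \<V>"
    and edge_interior: "\<lbrakk>e \<in> \<E>; 0 < t; t < 1\<rbrakk> \<Longrightarrow> e t \<notin> \<V>"
    and edges_meet: "\<lbrakk>e \<in> \<E>; e' \<in> \<E>; e \<noteq> e'\<rbrakk> \<Longrightarrow> path_image e \<inter> path_image e' \<subseteq> \<V>"
    and face_disc: "\<sigma> \<in> faces S \<V> \<E> \<Longrightarrow> \<sigma> homeomorphic cball (0::real^2) 1"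
    and vertex_edge: "v \<in> \<V> \<Longrightarrow> \<exists>e\<in>\<E>. v = pathstart e \<or> v = pathfinish e"
    and boundary_subset: "surface_boundary S \<subseteq> (\<Union>e\<in>\<E>. path_image e)"
    and interior_edge: "\<lbrakk>e \<in> \<E>; \<not> path_image e \<subseteq> surface_boundary S\<rbrakk> \<Longrightarrow>
      \<exists>\<sigma>\<in>faces S \<V> \<E>. \<exists>\<tau>\<in>faces S \<V> \<E>. \<sigma> \<noteq> \<tau> \<and>
        path_image e \<subseteq> disc_boundary \<sigma> \<and> path_image e \<subseteq> disc_boundary \<tau>"


section \<open>Orientations and discrete vector calculus\<close>

text \<open>An edge \<open>e\<close> has two orientations, represented by the curves \<open>e\<close> and \<open>reversepath e\<close>
  (different functions, also for loops).  The source and the sink of an oriented edge are its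
  \<open>pathstart\<close> and its \<open>pathfinish\<close>.\<close>

definition edge_orientations :: "(real \<Rightarrow> 'a::euclidean_space) \<Rightarrow> (real \<Rightarrow> 'a) set" where
  "edge_orientations e = {e, reversepath e}"

definition boundary_edges ::
    "(real \<Rightarrow> 'a::euclidean_space) set \<Rightarrow> 'a set \<Rightarrow> (real \<Rightarrow> 'a) set" where
  "boundary_edges \<E> \<sigma> = {e \<in> \<E>. path_image e \<subseteq> disc_boundary \<sigma>}"

definition face_orientation ::
    "(real \<Rightarrow> 'a::euclidean_space) set \<Rightarrow> 'a set \<Rightarrow> ((real \<Rightarrow> 'a) \<Rightarrow> (real \<Rightarrow> 'a)) \<Rightarrow> bool" where
  "face_orientation \<E> \<sigma> \<omega> \<longleftrightarrow>
     (\<forall>e\<in>boundary_edges \<E> \<sigma>. \<omega> e \<in> edge_orientations e) \<and>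
     ((\<exists>e. boundary_edges \<E> \<sigma> = {e} \<and> pathstart e = pathfinish e) \<or>
      (\<forall>e\<in>boundary_edges \<E> \<sigma>. \<exists>e'\<in>boundary_edges \<E> \<sigma>.
         e' \<noteq> e \<and> pathfinish (\<omega> e) = pathstart (\<omega> e')))"

record 'a cvf =
  cvf_orient :: "(real \<Rightarrow> 'a) \<Rightarrow> (real \<Rightarrow> 'a)"
  cvf_val :: "(real \<Rightarrow> 'a) \<Rightarrow> real"

definition is_cvf :: "(real \<Rightarrow> 'a::euclidean_space) set \<Rightarrow> 'a cvf \<Rightarrow> bool" where
  "is_cvf \<E> F \<longleftrightarrow> (\<forall>e\<in>\<E>. cvf_orient F e \<in> edge_orientations e)"

text \<open>Since the orientation of \<open>tilt f\<close> is a free choice on edges whose endpoints have equal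
  values, the tilt is rendered as a relation: \<open>F\<close> is a version of \<open>tilt f\<close>.  A vertex scalar
  field is a function on all points, of which only the values on vertices are used.\<close>

definition is_tilt ::
    "(real \<Rightarrow> 'a::euclidean_space) set \<Rightarrow> ('a \<Rightarrow> real) \<Rightarrow> 'a cvf \<Rightarrow> bool" where
  "is_tilt \<E> f F \<longleftrightarrow> is_cvf \<E> F \<and>
     (\<forall>e\<in>\<E>. let v = pathstart (cvf_orient F e); w = pathfinish (cvf_orient F e)
        in f v \<le> f w \<and> cvf_val F e = f w - f v)"

text \<open>The sign comparing the orientation \<open>\<gamma>\<close> of the edge \<open>e\<close> with the one given by \<open>F\<close>.\<close>

definition eps :: "(real \<Rightarrow> 'a::euclidean_space) \<Rightarrow> (real \<Rightarrow> 'a) \<Rightarrow> 'a cvf \<Rightarrow> real" where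
  "eps e \<gamma> F = (if \<gamma> = cvf_orient F e then 1 else -1)"

definition whirl ::
    "(real \<Rightarrow> 'a::euclidean_space) set \<Rightarrow> 'a cvf \<Rightarrow> 'a set \<Rightarrow> ((real \<Rightarrow> 'a) \<Rightarrow> (real \<Rightarrow> 'a)) \<Rightarrow> real"
  where
  "whirl \<E> F \<sigma> \<omega> = (\<Sum>e\<in>boundary_edges \<E> \<sigma>. eps e (\<omega> e) F * cvf_val F e)"

end

theory Submission
  imports Defs
begin

text \<open>Let \<open>s(e)\<close> and \<open>t(e)\<close> be the source and the sink of a boundary edge \<open>e\<close> of \<open>\<sigma>\<close> in the
  orientation given by \<open>\<omega>\<close>.  Reversing an edge changes both the sign of \<open>eps\<close> and that of the
  difference of \<open>f\<close> along it, so the whirl of a tilt is the sum of \<open>f(t(e)) - f(s(e))\<close>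
  (\<open>eps_times_tilt\<close>).  This vanishes for a single loop.  Otherwise the face orientation supplies a
  successor \<open>n(e) \<noteq> e\<close> of every boundary edge, with \<open>t(e) = s(n(e))\<close>, and the sum telescopes to
  zero once \<open>n\<close> is a permutation of the finite set of boundary edges, that is, once it is injective.

  Injectivity is where the topology enters.  If \<open>n\<close> maps distinct edges \<open>a\<close>, \<open>b\<close> to the same edge
  \<open>c\<close>, then \<open>a\<close>, \<open>b\<close>, \<open>c\<close> are three distinct edges with a common endpoint \<open>v\<close>.  They all lie in the
  boundary of \<open>\<sigma>\<close>, which by invariance of domain is a circle \<open>C\<close>
  (\<open>disc_boundary_eq_image\<close>).  The open edges are disjoint connected subsets of \<open>C - {v}\<close> that
  accumulate at \<open>v\<close>.  As \<open>C - {v}\<close> is a line, they correspond to three disjoint unbounded intervals,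
  but a line has only two ends (\<open>circle_two_ends\<close>).\<close>

section \<open>A circle has two ends at each of its points\<close>

lemma connected_unbounded_above_meet:
  fixes I J :: "real set"
  assumes "connected I" "connected J" "\<not> bdd_above I" "\<not> bdd_above J"
  shows "I \<inter> J \<noteq> {}"
proof -
  have upward: "\<exists>x. {x..} \<subseteq> K" if K: "connected K" "\<not> bdd_above K" for K :: "real set"
  proof -
    obtain x where x: "x \<in> K"
      using K(2) by (metis bdd_above_empty equals0I)
    have "y \<in> K" if "x \<le> y" for y
    proof -
      obtain z where "z \<in> K" "y < z"
        using K(2) by (meson bdd_above.I not_le)
      then show ?thesis
        using K(1) x that by (meson connected_iff_interval less_imp_le)
    qed
    then show ?thesis by auto
  qed
  obtain x y where "{x..} \<subseteq> I" "{y..} \<subseteq> J"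
    using upward[OF assms(1,3)] upward[OF assms(2,4)] by blast
  then have "max x y \<in> I \<inter> J" by auto
  then show ?thesis by blast
qed

lemma connected_unbounded_below_meet:
  fixes I J :: "real set"
  assumes "connected I" "connected J" "\<not> bdd_below I" "\<not> bdd_below J"
  shows "I \<inter> J \<noteq> {}"
proof -
  have "uminus ` I \<inter> uminus ` J \<noteq> {}"
    using assms
    by (intro connected_unbounded_above_meet connected_continuous_image continuous_intros) auto
  then show ?thesis by auto
qed

lemma three_unbounded_connected_meet:
  fixes I J K :: "real set"
  assumes "connected I" "connected J" "connected K"
    and "\<not> bounded I" "\<not> bounded J" "\<not> bounded K"
  shows "I \<inter> J \<noteq> {} \<or> I \<inter> K \<noteq> {} \<or> J \<inter> K \<noteq> {}"
proof -
  have "\<not> bdd_above L \<or> \<not> bdd_below L" if "\<not> bounded L" for L :: "real set"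
    using that bounded_subset[OF bounded_closed_interval] unfolding bdd_above_def bdd_below_def
    by (metis atLeastAtMost_iff subsetI)
  then show ?thesis
    using assms connected_unbounded_above_meet connected_unbounded_below_meet by metis
qed

lemma punctured_circle_homeomorphic_line:
  fixes C :: "'a::euclidean_space set"
  assumes "C homeomorphic sphere (0::real^2) 1" "v \<in> C"
  shows "(C - {v}) homeomorphic (UNIV :: real set)"
proof -
  obtain g h where gh: "homeomorphism C (sphere (0::real^2) 1) g h"
    using assms(1) homeomorphic_def by blast
  have gv: "g v \<in> sphere 0 1"
    using gh assms(2) by (auto simp: homeomorphism_def)
  have "inj_on g C" "g ` C = sphere 0 1"
    using gh by (auto simp: homeomorphism_def intro: inj_on_inverseI)
  then have "g ` (C - {v}) = sphere 0 1 - {g v}"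
    using inj_on_image_set_diff[of g C C "{v}"] assms(2) by auto
  then have "homeomorphism (C - {v}) (sphere 0 1 - {g v}) g h"
    by (intro homeomorphism_of_subsets[OF gh]) auto
  then have "(C - {v}) homeomorphic (sphere 0 1 - {g v})"
    using homeomorphic_def by blast
  also have "\<dots> homeomorphic {x::real^2. axis 1 1 \<bullet> x = 0}"
    using gv by (intro homeomorphic_punctured_sphere_hyperplane) (auto simp: axis_eq_0_iff)
  also have "\<dots> homeomorphic (UNIV :: real set)"
    by (intro homeomorphic_affine_sets) (auto simp: affine_hyperplane aff_dim_hyperplane axis_eq_0_iff)
  finally show ?thesis .
qed

text \<open>A set accumulating at the puncture \<open>v\<close> becomes unbounded on the line: a bounded set would lie
  in a compact interval, whose image in \<open>C - {v}\<close> is closed and stays away from \<open>v\<close>.\<close>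

lemma circle_two_ends:
  fixes C :: "'a::euclidean_space set"
  assumes C: "C homeomorphic sphere (0::real^2) 1" "v \<in> C"
    and A: "connected A1" "connected A2" "connected A3"
    and sub: "A1 \<subseteq> C - {v}" "A2 \<subseteq> C - {v}" "A3 \<subseteq> C - {v}"
    and cl: "v \<in> closure A1" "v \<in> closure A2" "v \<in> closure A3"
  shows "A1 \<inter> A2 \<noteq> {} \<or> A1 \<inter> A3 \<noteq> {} \<or> A2 \<inter> A3 \<noteq> {}"
proof -
  obtain g h where gh: "homeomorphism (C - {v}) (UNIV :: real set) g h"
    using punctured_circle_homeomorphic_line[OF C] homeomorphic_def by blast
  have inj: "inj_on g (C - {v})"
    using gh by (auto simp: homeomorphism_def intro: inj_on_inverseI)
  have conn: "connected (g ` A)" if "connected A" "A \<subseteq> C - {v}" for A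
    using that homeomorphism_cont1[OF gh]
    by (meson connected_continuous_image continuous_on_subset)
  have unb: "\<not> bounded (g ` A)" if "A \<subseteq> C - {v}" "v \<in> closure A" for A
  proof
    assume "bounded (g ` A)"
    then have "compact (h ` closure (g ` A))"
      using homeomorphism_cont2[OF gh]
      by (meson compact_closure compact_continuous_image continuous_on_subset top_greatest)
    moreover have "A \<subseteq> h ` closure (g ` A)"
    proof
      fix a assume "a \<in> A"
      then have "g a \<in> closure (g ` A)" "h (g a) = a"
        using that(1) gh closure_subset[of "g ` A"] by (auto simp: homeomorphism_def)
      then show "a \<in> h ` closure (g ` A)"
        by (metis imageI)
    qed
    ultimately have "closure A \<subseteq> h ` closure (g ` A)"
      by (simp add: closure_minimal compact_imp_closed)
    moreover have "range h = C - {v}"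
      using gh by (simp add: homeomorphism_def)
    ultimately show False
      using that(2) by auto
  qed
  have meet: "A \<inter> B \<noteq> {}" if "g ` A \<inter> g ` B \<noteq> {}" "A \<subseteq> C - {v}" "B \<subseteq> C - {v}" for A B
    using that inj by (metis image_empty inj_on_image_Int)
  show ?thesis
    using three_unbounded_connected_meet[OF conn[OF A(1) sub(1)] conn[OF A(2) sub(2)]
        conn[OF A(3) sub(3)] unb[OF sub(1) cl(1)] unb[OF sub(2) cl(2)] unb[OF sub(3) cl(3)]]
      meet sub by blast
qed

section \<open>The boundary of a face is a circle\<close>

lemma homeomorphism_cball_maps_ball:
  fixes g h :: "'a::euclidean_space \<Rightarrow> 'a"
  assumes "homeomorphism (cball a r) (cball a r) g h"
  shows "g ` ball a r \<subseteq> ball a r"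
proof -
  have "continuous_on (cball a r) g" "g ` cball a r = cball a r"
    using assms by (auto simp: homeomorphism_def)
  moreover have "inj_on g (cball a r)"
    using assms by (auto simp: homeomorphism_def intro: inj_on_inverseI)
  ultimately show ?thesis
    using continuous_image_subset_interior[of "cball a r" g] by auto
qed

text \<open>Two parametrizations \<open>h\<close>, \<open>h'\<close> of the disc differ by a self-homeomorphism of the standard disc,
  which preserves the open disc and hence cannot carry a point of the circle into it.\<close>

lemma disc_boundary_eq_image:
  fixes \<sigma> :: "'a::euclidean_space set"
  assumes hk: "homeomorphism (cball (0::real^2) 1) \<sigma> h k"
  shows "disc_boundary \<sigma> = h ` sphere 0 1"
proof
  show "h ` sphere 0 1 \<subseteq> disc_boundary \<sigma>"
    using hk unfolding disc_boundary_def by blast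
  show "disc_boundary \<sigma> \<subseteq> h ` sphere 0 1"
  proof
    fix y assume "y \<in> disc_boundary \<sigma>"
    then obtain h' k' x where h': "homeomorphism (cball (0::real^2) 1) \<sigma> h' k'"
      and x: "x \<in> sphere 0 1" and y: "y = h' x"
      unfolding disc_boundary_def by blast
    have "x \<in> cball 0 1" using x by auto
    then have y\<sigma>: "y \<in> \<sigma>" using h' y by (auto simp: homeomorphism_def)
    have ky: "k y \<in> cball 0 1" "h (k y) = y"
      using hk y\<sigma> by (auto simp: homeomorphism_def)
    have "homeomorphism (cball 0 1) (cball 0 1) (k' \<circ> h) (k \<circ> h')"
      using homeomorphism_compose[OF hk homeomorphism_symD[OF h']] .
    then have "(k' \<circ> h) ` ball 0 1 \<subseteq> ball 0 1"
      by (rule homeomorphism_cball_maps_ball)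
    moreover have "(k' \<circ> h) (k y) = x"
      using ky y h' \<open>x \<in> cball 0 1\<close> by (simp add: homeomorphism_def)
    ultimately have "k y \<notin> ball 0 1"
      using x by fastforce
    then have "k y \<in> sphere 0 1" using ky(1) by simp
    then show "y \<in> h ` sphere 0 1" using ky(2) by (metis imageI)
  qed
qed

lemma disc_boundary_circle:
  fixes \<sigma> :: "'a::euclidean_space set"
  assumes "\<sigma> homeomorphic cball (0::real^2) 1"
  shows "disc_boundary \<sigma> homeomorphic sphere (0::real^2) 1"
proof -
  obtain h k where hk: "homeomorphism (cball (0::real^2) 1) \<sigma> h k"
    using assms[THEN homeomorphic_sym[THEN iffD1]] by (auto simp: homeomorphic_def)
  have "homeomorphism (sphere 0 1) (h ` sphere 0 1) h k"
    by (rule homeomorphism_of_subsets[OF hk]) auto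
  then show ?thesis
    unfolding disc_boundary_eq_image[OF hk] homeomorphic_def
    by (blast dest: homeomorphism_symD)
qed

section \<open>At most two boundary edges meet at a vertex\<close>

lemma path_endpoints_in_closure_open_path:
  fixes p :: "real \<Rightarrow> 'a::topological_space"
  assumes "path p"
  shows "{pathstart p, pathfinish p} \<subseteq> closure (p ` {0<..<1})"
proof -
  have "continuous_on (closure {0<..<1}) p"
    using assms by (simp add: path_def)
  then have "p ` closure {0<..<1} \<subseteq> closure (p ` {0<..<1})"
    by (rule image_closure_subset) (auto simp: closure_subset)
  then show ?thesis
    by (auto simp: pathstart_def pathfinish_def)
qed

context combinatorial_surface
begin

lemma open_edges_disjoint:
  assumes "e \<in> \<E>" "e' \<in> \<E>" "e \<noteq> e'"
  shows "e ` {0<..<1} \<inter> e' ` {0<..<1} = {}"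
proof -
  have "p ` {0<..<1} \<subseteq> path_image p" for p :: "real \<Rightarrow> 'a"
    by (auto simp: path_image_def)
  moreover have "e ` {0<..<1} \<inter> \<V> = {}"
    using edge_interior assms(1) by auto
  ultimately show ?thesis
    using edges_meet[OF assms] by blast
qed

text \<open>Distinct edges are counted, not edge ends, so loops need no separate treatment: the interior of
  a loop accumulates at its base point like that of any other edge at its endpoints.\<close>

lemma boundary_vertex_degree:
  assumes \<sigma>: "\<sigma> \<in> faces S \<V> \<E>"
    and edges: "{a, b, c} \<subseteq> boundary_edges \<E> \<sigma>"
    and ends: "v \<in> {pathstart a, pathfinish a}" "v \<in> {pathstart b, pathfinish b}"
      "v \<in> {pathstart c, pathfinish c}"
  shows "a = b \<or> a = c \<or> b = c"
proof -
  let ?C = "disc_boundary \<sigma>" and ?o = "\<lambda>e. e ` {0<..<1::real}"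
  have *: "e \<in> \<E> \<and> connected (?o e) \<and> ?o e \<subseteq> ?C - {v} \<and> v \<in> closure (?o e) \<and> v \<in> ?C"
    if "e \<in> boundary_edges \<E> \<sigma>" "v \<in> {pathstart e, pathfinish e}" for e
  proof -
    have e: "e \<in> \<E>" "path_image e \<subseteq> ?C"
      using that(1) by (auto simp: boundary_edges_def)
    have "path e"
      using edge_curve[OF e(1)] by (simp add: embedded_C1_curve_def simple_path_def)
    then have "continuous_on {0<..<1} e"
      unfolding path_def by (rule continuous_on_subset) auto
    then have "connected (?o e)"
      by (rule connected_continuous_image) simp
    moreover have "?o e \<subseteq> path_image e"
      by (auto simp: path_image_def)
    moreover have "v \<in> \<V>"
      using edge_endpoints[OF e(1)] that(2) by auto
    moreover have "?o e \<inter> \<V> = {}"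
      using edge_interior[OF e(1)] by auto
    moreover have "v \<in> closure (?o e)"
      using path_endpoints_in_closure_open_path[OF \<open>path e\<close>] that(2) by blast
    moreover have "v \<in> path_image e"
      using that(2) by auto
    ultimately show ?thesis
      using e by blast
  qed
  have "?C homeomorphic sphere (0::real^2) 1"
    using disc_boundary_circle face_disc[OF \<sigma>] by blast
  moreover note * [of a] * [of b] * [of c] edges ends
  ultimately have "?o a \<inter> ?o b \<noteq> {} \<or> ?o a \<inter> ?o c \<noteq> {} \<or> ?o b \<inter> ?o c \<noteq> {}"
    by (intro circle_two_ends[of ?C v]) auto
  moreover have "a \<in> \<E>" "b \<in> \<E>" "c \<in> \<E>"
    using edges by (auto simp: boundary_edges_def)
  ultimately show ?thesis
    using open_edges_disjoint by blast
qed

end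

section \<open>The whirl of a tilt\<close>

lemma eps_times_tilt:
  assumes "is_tilt \<E> f F" "e \<in> \<E>" "\<gamma> \<in> edge_orientations e"
  shows "eps e \<gamma> F * cvf_val F e = f (pathfinish \<gamma>) - f (pathstart \<gamma>)"
proof -
  let ?o = "cvf_orient F e"
  have "?o \<in> edge_orientations e"
    using assms by (simp add: is_tilt_def is_cvf_def)
  then have "\<gamma> = ?o \<or> \<gamma> \<noteq> ?o \<and> \<gamma> = reversepath ?o"
    using assms(3) by (metis edge_orientations_def insertE reversepath_reversepath singletonD)
  moreover have "cvf_val F e = f (pathfinish ?o) - f (pathstart ?o)"
    using assms(1,2) by (simp add: is_tilt_def Let_def)
  ultimately show ?thesis
    by (elim disjE conjE) (simp_all add: eps_def)
qed

lemma sum_telescopes_along_successor: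
  fixes g :: "'v \<Rightarrow> real"
  assumes "finite B" "n ` B \<subseteq> B" "inj_on n B" "\<And>e. e \<in> B \<Longrightarrow> t e = s (n e)"
  shows "(\<Sum>e\<in>B. g (t e) - g (s e)) = 0"
proof -
  have "bij_betw n B B"
    using assms(1-3) by (simp add: bij_betw_def endo_inj_surj)
  then have "(\<Sum>e\<in>B. g (s (n e))) = (\<Sum>e\<in>B. g (s e))"
    by (rule sum.reindex_bij_betw)
  then show ?thesis
    using assms(4) by (simp add: sum_subtractf)
qed

theorem mainTheorem2:
  fixes S :: "(real^'n) set" and \<V> :: "(real^'n) set" and \<E> :: "(real \<Rightarrow> real^'n) set"
    and f :: "real^'n \<Rightarrow> real" and F :: "(real^'n) cvf"
    and \<sigma> :: "(real^'n) set" and \<omega> :: "(real \<Rightarrow> real^'n) \<Rightarrow> (real \<Rightarrow> real^'n)"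
  assumes "combinatorial_surface S \<V> \<E>"
    and "is_tilt \<E> f F"
    and "\<sigma> \<in> faces S \<V> \<E>"
    and "face_orientation \<E> \<sigma> \<omega>"
  shows "whirl \<E> F \<sigma> \<omega> = 0"
proof -
  interpret combinatorial_surface S \<V> \<E> by fact
  let ?B = "boundary_edges \<E> \<sigma>"
  let ?s = "\<lambda>e. pathstart (\<omega> e)" and ?t = "\<lambda>e. pathfinish (\<omega> e)"
  have B: "?B \<subseteq> \<E>" "finite ?B"
    using finite_edges by (auto simp: boundary_edges_def)
  have \<omega>: "\<omega> e \<in> edge_orientations e" if "e \<in> ?B" for e
    using assms(4) that by (simp add: face_orientation_def)
  have ends: "?s e \<in> {pathstart e, pathfinish e} \<and> ?t e \<in> {pathstart e, pathfinish e}"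
    if "e \<in> ?B" for e
    using \<omega>[OF that] by (auto simp: edge_orientations_def)
  have whirl_eq: "whirl \<E> F \<sigma> \<omega> = (\<Sum>e\<in>?B. f (?t e) - f (?s e))"
    unfolding whirl_def using B(1) \<omega> by (intro sum.cong refl eps_times_tilt[OF assms(2)]) auto
  consider (loop) e where "?B = {e}" "pathstart e = pathfinish e"
    | (cycle) "\<forall>e\<in>?B. \<exists>e'\<in>?B. e' \<noteq> e \<and> ?t e = ?s e'"
    using assms(4) unfolding face_orientation_def by blast
  then show ?thesis
  proof cases
    case loop
    then show ?thesis
      using ends[of e] by (simp add: whirl_eq)
  next
    case cycle
    then obtain n where n: "\<And>e. e \<in> ?B \<Longrightarrow> n e \<in> ?B \<and> n e \<noteq> e \<and> ?t e = ?s (n e)"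
      by metis
    have "inj_on n ?B"
    proof (rule inj_onI)
      fix a b assume ab: "a \<in> ?B" "b \<in> ?B" "n a = n b"
      \<comment> \<open>The sinks of \<open>a\<close> and \<open>b\<close> both coincide with the source of their common successor.\<close>
      have "a = b \<or> a = n a \<or> b = n a"
        using n[OF ab(1)] n[OF ab(2)] ends[OF ab(1)] ends[OF ab(2)] ends[of "n a"] ab
        by (intro boundary_vertex_degree[OF assms(3), where v = "?s (n a)"]) auto
      then show "a = b"
        using n[OF ab(1)] n[OF ab(2)] ab(3) by auto
    qed
    then show ?thesis
      unfolding whirl_eq using n B(2)
      by (intro sum_telescopes_along_successor[where n = n]) auto
  qed
qed

end
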